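(* Let $G$ be an infinite abelian group. Every additive basis of $G$ has only finitely many essential subsets.
   Context: For subsets $A,B$ of an abelian semigroup, $A\sim B$ means that the symmetric difference of $A$ and $B$ is finite. $hA$ denotes the $h$-fold Minkowski sum $A+\cdots+A$ ($h\ge 1$ copies). A subset $A\subset G$ is an additive basis of $G$ if $hA\sim G$ for some integer $h\ge 1$. Let $A$ be an additive basis of $G$. A subset $F\subset A$ is exceptional if $A\setminus F$ is not an additive basis of $G$. An essential subset of $A$ is a finite exceptional subset of $A$ that is minimal, with respect to inclusion, among the exceptional subsets of $A$. *)

theory Defs
  imports Main "HOL-Library.Set_Algebras"
begin

text \<open>The ambient group is a type of class \<open>ab_group_add\<close>, so the whole group is \<open>UNIV\<close>.
  Sums of sets are the pointwise (Minkowski) sums of \<open>Set_Algebras\<close>.\<close>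

definition almost_equal :: "'a set \<Rightarrow> 'a set \<Rightarrow> bool"
  where "almost_equal A B \<longleftrightarrow> finite (sym_diff A B)"

text \<open>The zero of the monoid of sets is \<open>{0}\<close>, so \<open>hfold 0 A = {0}\<close>; only \<open>h \<ge> 1\<close> is used below.\<close>

definition hfold :: "nat \<Rightarrow> 'a::comm_monoid_add set \<Rightarrow> 'a set"
  where "hfold h A = (\<Sum>i<h. A)"

definition additive_basis :: "'a::ab_group_add set \<Rightarrow> bool"
  where "additive_basis A \<longleftrightarrow> (\<exists>h\<ge>1. almost_equal (hfold h A) UNIV)"

definition exceptional_subset :: "'a::ab_group_add set \<Rightarrow> 'a set \<Rightarrow> bool"
  where "exceptional_subset A F \<longleftrightarrow> F \<subseteq> A \<and> \<not> additive_basis (A - F)"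

definition essential_subset :: "'a::ab_group_add set \<Rightarrow> 'a set \<Rightarrow> bool"
  where "essential_subset A F \<longleftrightarrow>
    finite F \<and> exceptional_subset A F \<and> (\<forall>E. E \<subset> F \<longrightarrow> \<not> exceptional_subset A E)"

end

theory Submission
  imports Defs
begin

text \<open>
  For \<open>B\<close> with \<open>A - B\<close> finite, \<open>B\<close> is again a basis iff the differences of \<open>B\<close> generate \<open>G\<close>, i.e. iff
  \<open>B\<close> lies in no coset of a proper subgroup. So consider the subgroups \<open>H\<close> having a coset that contains
  all but finitely many elements of \<open>A\<close>; they are closed under intersection. If there were no
  least one, then by induction on \<open>h\<close> every coset of such an \<open>H\<close> would contain a coset of a smaller
  such subgroup that misses \<open>hA\<close>, and this is impossible once \<open>hA\<close> is cofinite. Hence there is a least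
  one \<open>M\<close>, with coset \<open>b + M\<close> say, and by minimality every essential subset is contained in the
  finite set \<open>A - (b + M)\<close>.
\<close>

section \<open>Iterated sumsets\<close>

lemma hfold_0: "hfold 0 A = {0}"
  by (simp add: hfold_def)

lemma hfold_Suc: "hfold (Suc h) A = A + hfold h A"
  by (simp add: hfold_def add.commute)

lemma hfold_add: "hfold (m + n) A = hfold m A + hfold n A"
  by (induction m) (simp_all add: hfold_0 hfold_Suc add.assoc flip: set_zero)

lemma hfold_1: "hfold 1 A = A"
  by (simp add: hfold_def)

lemma hfold_mono: "A \<subseteq> B \<Longrightarrow> hfold h A \<subseteq> hfold h B"
  by (induction h) (simp_all add: hfold_0 hfold_Suc set_plus_mono2)

lemma finite_hfold: "finite A \<Longrightarrow> finite (hfold h A)"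
  by (induction h) (simp_all add: hfold_0 hfold_Suc finite_set_plus)

lemma hfold_addI: "x \<in> hfold m A \<Longrightarrow> y \<in> hfold n A \<Longrightarrow> x + y \<in> hfold (m + n) A"
  by (auto simp: hfold_add)

lemma additive_basis_iff: "additive_basis A \<longleftrightarrow> (\<exists>h\<ge>1. finite (- hfold h A))"
  by (simp add: additive_basis_def almost_equal_def Compl_eq_Diff_UNIV)

lemma infinite_additive_basis:
  fixes A :: "'a::ab_group_add set"
  assumes "infinite (UNIV :: 'a set)" "additive_basis A"
  shows "infinite A"
proof
  assume "finite A"
  obtain h where "finite (- hfold h A)"
    using assms(2) by (auto simp: additive_basis_iff)
  with finite_hfold[OF \<open>finite A\<close>, of h] have "finite (hfold h A \<union> - hfold h A)"
    by blast
  with assms(1) show False by simp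
qed

section \<open>Subgroups and their cosets\<close>

definition additive_subgroup :: "'a::ab_group_add set \<Rightarrow> bool"
  where "additive_subgroup H \<longleftrightarrow> 0 \<in> H \<and> (\<forall>x\<in>H. \<forall>y\<in>H. x - y \<in> H)"

lemma additive_subgroup_0: "additive_subgroup H \<Longrightarrow> 0 \<in> H"
  by (simp add: additive_subgroup_def)

lemma additive_subgroup_diff: "additive_subgroup H \<Longrightarrow> x \<in> H \<Longrightarrow> y \<in> H \<Longrightarrow> x - y \<in> H"
  by (simp add: additive_subgroup_def)

lemma additive_subgroup_minus: "additive_subgroup H \<Longrightarrow> x \<in> H \<Longrightarrow> - x \<in> H"
  using additive_subgroup_diff[of H 0 x] by (simp add: additive_subgroup_0)

lemma additive_subgroup_add: "additive_subgroup H \<Longrightarrow> x \<in> H \<Longrightarrow> y \<in> H \<Longrightarrow> x + y \<in> H"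
  using additive_subgroup_diff[of H x "- y"] by (simp add: additive_subgroup_minus)

lemma additive_subgroup_Int:
  "additive_subgroup H \<Longrightarrow> additive_subgroup K \<Longrightarrow> additive_subgroup (H \<inter> K)"
  by (auto simp: additive_subgroup_def)

lemma mem_coset_iff: "(x::'a::ab_group_add) \<in> c +o H \<longleftrightarrow> x - c \<in> H"
  by (simp add: set_minus_plus)

lemma coset_eqI:
  assumes "additive_subgroup H" "d \<in> c +o H"
  shows "c +o H = d +o H"
proof -
  have "x - c \<in> H \<longleftrightarrow> x - d \<in> H" for x
    using additive_subgroup_diff[OF assms(1), of "x - c" "d - c"]
      additive_subgroup_add[OF assms(1), of "x - d" "d - c"] assms(2)
    by (auto simp: mem_coset_iff)
  then show ?thesis by (auto simp: mem_coset_iff)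
qed

lemma hfold_coset_subset:
  assumes "additive_subgroup H"
  shows "\<exists>d. hfold k (c +o H) \<subseteq> d +o H"
proof (induction k)
  case 0
  show ?case
    by (rule exI[of _ 0]) (simp add: hfold_0 mem_coset_iff additive_subgroup_0[OF assms])
next
  case (Suc k)
  then obtain d where d: "hfold k (c +o H) \<subseteq> d +o H" by blast
  have "x + y \<in> (c + d) +o H" if "x \<in> c +o H" "y \<in> hfold k (c +o H)" for x y
    using additive_subgroup_add[OF assms, of "x - c" "y - d"] that d
    by (auto simp: mem_coset_iff subset_iff algebra_simps)
  then show ?case
    by (auto simp: hfold_Suc elim!: set_plus_elim)
qed

lemma finite_coset_iff: "finite (c +o H) \<longleftrightarrow> finite (H :: 'a::ab_group_add set)"
proof -
  have "c +o H = (+) c ` H" by (auto simp: elt_set_plus_def)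
  then show ?thesis by (simp add: finite_image_iff)
qed

text \<open>All \<open>k\<close>-fold sums from \<open>B\<close> stay in a single coset
  \<open>d +o H\<close>. If \<open>H\<close> were proper, a second coset would lie in the finite
  complement, so \<open>H\<close>, and then the whole group, would be finite.\<close>

lemma basis_in_coset_imp_UNIV:
  fixes H :: "'a::ab_group_add set"
  assumes inf: "infinite (UNIV :: 'a set)" and H: "additive_subgroup H"
    and "additive_basis B" "B \<subseteq> c +o H"
  shows "H = UNIV"
proof (rule ccontr)
  assume "H \<noteq> UNIV"
  then obtain x where x: "x \<notin> H" by blast
  obtain k where "finite (- hfold k B)"
    using assms(3) by (auto simp: additive_basis_iff)
  moreover obtain d where "hfold k (c +o H) \<subseteq> d +o H"
    using hfold_coset_subset[OF H] by blast
  then have "hfold k B \<subseteq> d +o H"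
    using hfold_mono[OF assms(4), of k] by blast
  ultimately have fin: "finite (- (d +o H))"
    by (meson Compl_subset_Compl_iff finite_subset)
  have "(d + x) +o H \<subseteq> - (d +o H)"
  proof
    fix y assume "y \<in> (d + x) +o H"
    then show "y \<in> - (d +o H)"
      using x additive_subgroup_diff[OF H, of "y - d" "y - (d + x)"]
      by (auto simp: mem_coset_iff)
  qed
  then have "finite H"
    using fin finite_subset finite_coset_iff by blast
  then have "finite ((d +o H) \<union> - (d +o H))"
    using fin finite_coset_iff[of d H] by blast
  with inf show False by simp
qed

section \<open>Differences that generate the group\<close>

text \<open>The subgroup generated by \<open>B - B\<close>.\<close>

definition difference_subgroup :: "'a::ab_group_add set \<Rightarrow> 'a set"
  where "difference_subgroup B = {p - q |p q k. p \<in> hfold k B \<and> q \<in> hfold k B}"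

lemma difference_subgroupI:
  "p \<in> hfold k B \<Longrightarrow> q \<in> hfold k B \<Longrightarrow> p - q \<in> difference_subgroup B"
  by (auto simp: difference_subgroup_def)

lemma additive_subgroup_difference_subgroup: "additive_subgroup (difference_subgroup B)"
proof -
  have "0 \<in> difference_subgroup B"
    using difference_subgroupI[of 0 0 B 0] by (simp add: hfold_0)
  moreover have "x - y \<in> difference_subgroup B"
    if x: "x \<in> difference_subgroup B" and y: "y \<in> difference_subgroup B" for x y
  proof -
    obtain p q k where 1: "x = p - q" "p \<in> hfold k B" "q \<in> hfold k B"
      using x by (auto simp: difference_subgroup_def)
    obtain r s l where 2: "y = r - s" "r \<in> hfold l B" "s \<in> hfold l B"
      using y by (auto simp: difference_subgroup_def)
    have "x - y = (p + s) - (q + r)"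
      using 1 2 by (simp add: algebra_simps)
    then show ?thesis
      using difference_subgroupI[OF hfold_addI[OF 1(2) 2(3)] hfold_addI[OF 1(3) 2(2)]] by simp
  qed
  ultimately show ?thesis by (simp add: additive_subgroup_def)
qed

lemma subset_coset_difference_subgroup:
  assumes "b \<in> B"
  shows "B \<subseteq> b +o difference_subgroup B"
  using assms difference_subgroupI[of _ 1 B b] unfolding hfold_1 by (auto simp: mem_coset_iff)

text \<open>Elements of the difference subgroup act like fractions \<open>r - s\<close>. Adding the
  denominator \<open>s\<close> of a new element to \<open>q\<close> keeps the old numerators inside
  the longer sumset and supplies the new one, \<open>q + r\<close>.\<close>

lemma common_denominator:
  assumes "finite T" "T \<subseteq> difference_subgroup B"
  shows "\<exists>m q. q \<in> hfold m B \<and> (\<forall>t\<in>T. q + t \<in> hfold m B)"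
  using assms
proof (induction T rule: finite_induct)
  case empty
  then show ?case by (auto intro!: exI[of _ 0] simp: hfold_0)
next
  case (insert t T)
  then obtain m q where q: "q \<in> hfold m B" "\<And>t. t \<in> T \<Longrightarrow> q + t \<in> hfold m B"
    by auto
  obtain r s k where t: "t = r - s" "r \<in> hfold k B" "s \<in> hfold k B"
    using insert.prems by (auto simp: difference_subgroup_def)
  have "(q + s) + t' \<in> hfold (m + k) B" if "t' \<in> T" for t'
    using hfold_addI[OF q(2)[OF that] t(3)] by (simp add: algebra_simps)
  moreover have "(q + s) + t \<in> hfold (m + k) B"
    using hfold_addI[OF q(1) t(2)] t(1) by simp
  ultimately show ?case
    using hfold_addI[OF q(1) t(3)] by blast
qed

text \<open>Each of the \<open>h\<close> summands receives its own copy of \<open>q\<close>, so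
  \<open>c\<close> is \<open>q\<close> added \<open>h\<close> times.\<close>

lemma hfold_translate:
  fixes A B :: "'a::ab_group_add set"
  assumes "\<And>a. a \<in> A \<Longrightarrow> q + a \<in> hfold m B"
  shows "\<exists>c. \<forall>x \<in> hfold h A. c + x \<in> hfold (h * m) B"
proof (induction h)
  case 0
  show ?case by (auto intro!: exI[of _ 0] simp: hfold_0)
next
  case (Suc h)
  then obtain c where c: "\<And>x. x \<in> hfold h A \<Longrightarrow> c + x \<in> hfold (h * m) B" by blast
  have "(q + c) + (a + x) \<in> hfold (Suc h * m) B" if "a \<in> A" "x \<in> hfold h A" for a x
    using hfold_addI[OF assms[OF that(1)] c[OF that(2)]] by (simp add: algebra_simps)
  then show ?case
    by (auto simp: hfold_Suc elim!: set_plus_elim)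
qed

text \<open>One shift \<open>q\<close> carries all of \<open>A\<close> into
  \<open>hfold (m + 1) B\<close>, because only finitely many elements lie outside \<open>B\<close>.
  Hence some \<open>hfold (h * (m + 1)) B\<close> contains a translate of the cofinite set
  \<open>hfold h A\<close>.\<close>

lemma basis_if_difference_subgroup_UNIV:
  fixes A B :: "'a::ab_group_add set"
  assumes "additive_basis A" "finite (A - B)" "B \<noteq> {}" "difference_subgroup B = UNIV"
  shows "additive_basis B"
proof -
  obtain b where b: "b \<in> B" using assms(3) by blast
  \<comment> \<open>The offset \<open>b\<close> equalizes lengths:
    \<open>q + f = (q + (f - b)) + b\<close> has exactly \<open>m + 1\<close> summands, just as
    \<open>q + a\<close> has for \<open>a\<close> in \<open>B\<close>.\<close>
  obtain m q where mq: "q \<in> hfold m B" "\<And>f. f \<in> A - B \<Longrightarrow> q + (f - b) \<in> hfold m B"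
    using common_denominator[of "(\<lambda>f. f - b) ` (A - B)" B] assms(2,4) by auto
  have B1: "x \<in> hfold 1 B" if "x \<in> B" for x
    using that by (simp only: hfold_1)
  have "q + a \<in> hfold (m + 1) B" if "a \<in> A" for a
  proof (cases "a \<in> B")
    case True
    then show ?thesis using hfold_addI[OF mq(1) B1] by blast
  next
    case False
    then show ?thesis
      using hfold_addI[OF mq(2)[of a] B1[OF b]] that by (simp add: algebra_simps)
  qed
  moreover obtain h where h: "h \<ge> 1" "finite (- hfold h A)"
    using assms(1) by (auto simp: additive_basis_iff)
  ultimately obtain c where c: "\<And>x. x \<in> hfold h A \<Longrightarrow> c + x \<in> hfold (h * (m + 1)) B"
    using hfold_translate[of A q "m + 1" B h] by blast
  have "- hfold (h * (m + 1)) B \<subseteq> (+) c ` (- hfold h A)"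
  proof
    fix y assume "y \<in> - hfold (h * (m + 1)) B"
    then have "y - c \<in> - hfold h A"
      using c[of "y - c"] by auto
    then show "y \<in> (+) c ` (- hfold h A)"
      by (metis add_diff_cancel_left' diff_add_cancel image_eqI add.commute)
  qed
  then have "finite (- hfold (h * (m + 1)) B)"
    using h(2) finite_subset by blast
  moreover have "h * (m + 1) \<ge> 1" using h(1) by simp
  ultimately show ?thesis
    unfolding additive_basis_iff by blast
qed

section \<open>Subgroups with a coset containing almost all of \<open>A\<close>\<close>

definition tail_subgroup :: "'a::ab_group_add set \<Rightarrow> 'a set \<Rightarrow> bool"
  where "tail_subgroup A H \<longleftrightarrow> additive_subgroup H \<and> (\<exists>b. finite (A - (b +o H)))"

lemma cofinite_inter_nonempty:
  assumes "infinite A" "finite (A - X)" "finite (A - Y)"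
  shows "\<exists>a\<in>A. a \<in> X \<and> a \<in> Y"
proof (rule ccontr)
  assume "\<not> ?thesis"
  then have "A \<subseteq> (A - X) \<union> (A - Y)" by blast
  then show False using assms by (meson finite_UnI finite_subset)
qed

text \<open>Since \<open>A\<close> is infinite, the two cosets share a point \<open>a\<close>;
  recentred at \<open>a\<close>, they intersect in a coset of \<open>H \<inter> K\<close>.\<close>

lemma tail_subgroup_Int:
  assumes A: "infinite A" and "tail_subgroup A H" "tail_subgroup A K"
  shows "tail_subgroup A (H \<inter> K)"
proof -
  obtain b c where H: "additive_subgroup H" "finite (A - (b +o H))"
    and K: "additive_subgroup K" "finite (A - (c +o K))"
    using assms(2,3) by (auto simp: tail_subgroup_def)
  obtain a where a: "a \<in> b +o H" "a \<in> c +o K"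
    using cofinite_inter_nonempty[OF A H(2) K(2)] by blast
  have "A - (a +o (H \<inter> K)) \<subseteq> (A - (a +o H)) \<union> (A - (a +o K))"
    by (auto simp: mem_coset_iff)
  moreover have "finite ((A - (a +o H)) \<union> (A - (a +o K)))"
    using H K coset_eqI[OF H(1) a(1)] coset_eqI[OF K(1) a(2)] by simp
  ultimately have "finite (A - (a +o (H \<inter> K)))"
    by (rule finite_subset)
  then show ?thesis
    using additive_subgroup_Int[OF H(1) K(1)] by (auto simp: tail_subgroup_def)
qed

text \<open>The coset is shrunk once for each element of \<open>S\<close>. To avoid
  \<open>a + X\<close> inside \<open>y +o K\<close>, \<open>avoid\<close> is applied to the coset
  shifted by \<open>- a\<close> and the result is shifted back.\<close>

lemma coset_avoiding_finite_translates:
  fixes X :: "'a::ab_group_add set"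
  assumes avoid: "\<And>x H. tail_subgroup A H \<Longrightarrow>
      \<exists>y K. tail_subgroup A K \<and> y +o K \<subseteq> x +o H \<and> (y +o K) \<inter> X = {}"
    and "finite S" "tail_subgroup A H"
  shows "\<exists>y K. tail_subgroup A K \<and> y +o K \<subseteq> x +o H \<and> (y +o K) \<inter> (S + X) = {}"
  using assms(2,3)
proof (induction S rule: finite_induct)
  case empty
  then show ?case by (auto elim!: set_plus_elim)
next
  case (insert a S)
  then obtain y K where K: "tail_subgroup A K" "y +o K \<subseteq> x +o H" "(y +o K) \<inter> (S + X) = {}"
    by blast
  obtain z L where L: "tail_subgroup A L" "z +o L \<subseteq> (y - a) +o K" "(z +o L) \<inter> X = {}"
    using avoid[OF K(1)] by blast
  have shift: "v - a \<in> z +o L" if "v \<in> (a + z) +o L" for v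
    using that by (simp add: mem_coset_iff algebra_simps)
  have sub: "(a + z) +o L \<subseteq> y +o K"
    using shift L(2) by (fastforce simp: mem_coset_iff algebra_simps)
  have "v \<notin> insert a S + X" if v: "v \<in> (a + z) +o L" for v
  proof
    assume "v \<in> insert a S + X"
    then obtain s w where sw: "v = s + w" "s = a \<or> s \<in> S" "w \<in> X"
      by (auto elim!: set_plus_elim)
    show False
    proof (cases "s = a")
      case True
      then have "w \<in> z +o L" using shift[OF v] sw(1) by simp
      then show False using L(3) sw(3) by blast
    next
      case False
      then have "v \<in> S + X" using sw by (auto intro: set_plus_intro)
      then show False using K(3) sub v by blast
    qed
  qed
  then show ?case using L(1) sub K(2) by blast
qed

text \<open>In the inductive step a coset of \<open>K\<close> contains all but finitely many
  elements of \<open>A\<close>. Summands inside it are excluded by the choice of \<open>y\<close>,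
  and the finitely many others by shrinking further.\<close>

lemma coset_avoiding_hfold:
  fixes A :: "'a::ab_group_add set"
  assumes A: "infinite A"
    and no_min: "\<And>H. tail_subgroup A H \<Longrightarrow> \<exists>K. tail_subgroup A K \<and> K \<subset> H"
    and "tail_subgroup A H"
  shows "\<exists>y K. tail_subgroup A K \<and> y +o K \<subseteq> x +o H \<and> (y +o K) \<inter> hfold h A = {}"
  using assms(3)
proof (induction h arbitrary: x H)
  case 0
  obtain K where K: "tail_subgroup A K" "K \<subset> H"
    using no_min[OF 0] by blast
  have sg: "additive_subgroup H" "additive_subgroup K"
    using 0 K by (auto simp: tail_subgroup_def)
  \<comment> \<open>The cosets of \<open>K\<close> through \<open>x\<close> and \<open>x + u\<close>
    are disjoint and both lie in \<open>x +o H\<close>, so at least one of them misses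
    \<open>0\<close>.\<close>
  obtain u where u: "u \<in> H" "u \<notin> K" using K(2) by blast
  have sub: "(x + t) +o K \<subseteq> x +o H" if t: "t \<in> H" for t
  proof
    fix v assume "v \<in> (x + t) +o K"
    then have "v - (x + t) \<in> H"
      using K(2) by (auto simp: mem_coset_iff)
    from additive_subgroup_add[OF sg(1) this t] show "v \<in> x +o H"
      by (simp add: mem_coset_iff algebra_simps)
  qed
  show ?case
  proof (cases "0 \<in> x +o K")
    case False
    then show ?thesis
      using K(1) sub[of 0] additive_subgroup_0[OF sg(1)] by (auto simp: hfold_0)
  next
    case True
    then have "0 \<notin> (x + u) +o K"
      using additive_subgroup_diff[OF sg(2), of "- x" "- (x + u)"] u(2)
      by (auto simp: mem_coset_iff)
    then show ?thesis
      using K(1) sub[OF u(1)] by (auto simp: hfold_0)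
  qed
next
  case (Suc h)
  obtain b where H: "additive_subgroup H" "finite (A - (b +o H))"
    using Suc.prems by (auto simp: tail_subgroup_def)
  \<comment> \<open>The shift by \<open>- b\<close> anticipates a later translation by some
    \<open>a\<close> in \<open>b +o H\<close>, which brings the coset back into
    \<open>x +o H\<close>.\<close>
  obtain y K where K: "tail_subgroup A K" "y +o K \<subseteq> (x - b) +o H" "(y +o K) \<inter> hfold h A = {}"
    using Suc.IH[OF Suc.prems] by blast
  obtain c where c: "additive_subgroup K" "finite (A - (c +o K))"
    using K(1) by (auto simp: tail_subgroup_def)
  obtain a where a: "a \<in> b +o H" "a \<in> c +o K"
    using cofinite_inter_nonempty[OF A H(2) c(2)] by blast
  have fin: "finite (A - (a +o K))"
    using c coset_eqI[OF c(1) a(2)] by simp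
  obtain z L where L: "tail_subgroup A L" "z +o L \<subseteq> (y + a) +o K"
    "(z +o L) \<inter> ((A - (a +o K)) + hfold h A) = {}"
    using coset_avoiding_finite_translates[OF Suc.IH fin K(1)] by blast
  have "(y + a) +o K \<subseteq> x +o H"
  proof
    fix v assume "v \<in> (y + a) +o K"
    then have "v - a \<in> y +o K"
      by (simp add: mem_coset_iff algebra_simps)
    then have "v - a - (x - b) \<in> H"
      using K(2) mem_coset_iff by blast
    moreover have "a - b \<in> H"
      using a(1) by (simp add: mem_coset_iff)
    ultimately have "v - a - (x - b) + (a - b) \<in> H"
      by (rule additive_subgroup_add[OF H(1)])
    then show "v \<in> x +o H"
      by (simp add: mem_coset_iff algebra_simps)
  qed
  moreover have "v \<notin> hfold (Suc h) A" if v: "v \<in> z +o L" for v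
  proof
    assume "v \<in> hfold (Suc h) A"
    then obtain s w where sw: "v = s + w" "s \<in> A" "w \<in> hfold h A"
      by (auto simp: hfold_Suc elim!: set_plus_elim)
    show False
    proof (cases "s \<in> a +o K")
      case True
      \<comment> \<open>As \<open>v = s + w\<close>, subtracting \<open>s - a\<close> from
        \<open>v - (y + a)\<close> leaves \<open>w - y\<close>, which puts \<open>w\<close> in the
        coset chosen to avoid \<open>hfold h A\<close>.\<close>
      have "v - (y + a) \<in> K"
        using v L(2) mem_coset_iff by blast
      from additive_subgroup_diff[OF c(1) this, of "s - a"] True
      have "w \<in> y +o K"
        using sw(1) by (simp add: mem_coset_iff algebra_simps)
      then show False using K(3) sw(3) by blast
    next
      case False
      then have "v \<in> (A - (a +o K)) + hfold h A"
        using sw by (auto intro: set_plus_intro)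
      then show False using L(3) v by blast
    qed
  qed
  ultimately show ?case using L(1,2) by blast
qed

text \<open>Without a minimal one, all these subgroups are infinite, yet some coset of one of them
  would fit into the finite complement of \<open>hfold h A\<close>.\<close>

lemma minimal_tail_subgroup_exists:
  fixes A :: "'a::ab_group_add set"
  assumes inf: "infinite (UNIV :: 'a set)" and basis: "additive_basis A"
  shows "\<exists>M. tail_subgroup A M \<and> (\<forall>K. tail_subgroup A K \<longrightarrow> \<not> K \<subset> M)"
proof (rule ccontr)
  assume "\<not> ?thesis"
  then have no_min: "\<exists>K. tail_subgroup A K \<and> K \<subset> H" if "tail_subgroup A H" for H
    using that by blast
  \<comment> \<open>A finite one would start an endless strict descent among finite sets.\<close>
  have infinite_tail: "infinite H" if "tail_subgroup A H" for H
  proof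
    assume "finite H"
    then show False using that
    proof (induction H rule: finite_psubset_induct)
      case (psubset H)
      then show False using no_min by blast
    qed
  qed
  have "A - (0 +o UNIV) = {}"
    by (auto simp: mem_coset_iff)
  then have "tail_subgroup A UNIV"
    unfolding tail_subgroup_def additive_subgroup_def by (metis UNIV_I finite.emptyI)
  moreover obtain h where h: "finite (- hfold h A)"
    using basis by (auto simp: additive_basis_iff)
  ultimately obtain y K where K: "tail_subgroup A K" "(y +o K) \<inter> hfold h A = {}"
    using coset_avoiding_hfold[OF infinite_additive_basis[OF inf basis] no_min] by blast
  then have "finite (y +o K)"
    using h by (meson disjoint_eq_subset_Compl finite_subset)
  then show False
    using infinite_tail[OF K(1)] by (simp add: finite_coset_iff)
qed

section \<open>Essential subsets\<close>

lemma essential_subset_eq_coset_complement: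
  fixes A :: "'a::ab_group_add set"
  assumes inf: "infinite (UNIV :: 'a set)" and basis: "additive_basis A"
    and F: "essential_subset A F"
  shows "\<exists>H c. additive_subgroup H \<and> F = A - (c +o H)"
proof -
  have F': "finite F" "F \<subseteq> A" "\<not> additive_basis (A - F)"
    and F_min: "\<And>E. E \<subset> F \<Longrightarrow> \<not> exceptional_subset A E"
    using F by (auto simp: essential_subset_def exceptional_subset_def)
  define H where "H = difference_subgroup (A - F)"
  have "infinite (A - F)"
    using infinite_additive_basis[OF inf basis] F'(1) by (rule Diff_infinite_finite[rotated])
  then obtain c where c: "c \<in> A - F"
    by (metis finite.emptyI ex_in_conv)
  have H: "additive_subgroup H"
    unfolding H_def by (rule additive_subgroup_difference_subgroup)
  have cH: "A - F \<subseteq> c +o H"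
    unfolding H_def by (rule subset_coset_difference_subgroup[OF c])
  have "finite (A - (A - F))"
    using F'(1) by (simp add: double_diff F'(2))
  then have "H \<noteq> UNIV"
    using basis_if_difference_subgroup_UNIV[OF basis] c F'(3) unfolding H_def by blast
  moreover have "A - (A - (c +o H)) \<subseteq> c +o H" by blast
  \<comment> \<open>What remains after this removal lies in a coset of the proper subgroup
    \<open>H\<close>. The removed set is contained in \<open>F\<close>, so minimality of
    \<open>F\<close> forces equality.\<close>
  ultimately have "exceptional_subset A (A - (c +o H))"
    using basis_in_coset_imp_UNIV[OF inf H] by (auto simp: exceptional_subset_def)
  moreover have "A - (c +o H) \<subseteq> F" using cH by blast
  ultimately have "F = A - (c +o H)"
    using F_min by blast
  with H show ?thesis by blast
qed

theorem theorem1: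
  fixes A :: "'a::ab_group_add set"
  assumes "infinite (UNIV :: 'a set)"
    and "additive_basis A"
  shows "finite {F. essential_subset A F}"
proof -
  have A: "infinite A"
    using infinite_additive_basis[OF assms] .
  obtain M where M: "tail_subgroup A M" and M_min: "\<And>K. tail_subgroup A K \<Longrightarrow> \<not> K \<subset> M"
    using minimal_tail_subgroup_exists[OF assms] by blast
  obtain b where b: "finite (A - (b +o M))"
    using M by (auto simp: tail_subgroup_def)
  have "F \<subseteq> A - (b +o M)" if F: "essential_subset A F" for F
  proof -
    obtain H c where H: "additive_subgroup H" and F_eq: "F = A - (c +o H)"
      using essential_subset_eq_coset_complement[OF assms F] by blast
    have fin: "finite (A - (c +o H))"
      using F F_eq by (simp add: essential_subset_def)
    \<comment> \<open>Closure under intersection makes the minimal \<open>M\<close> a least one: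
      \<open>M \<inter> H\<close> cannot be strictly smaller than \<open>M\<close>.\<close>
    then have "tail_subgroup A (M \<inter> H)"
      using tail_subgroup_Int[OF A M] H by (auto simp: tail_subgroup_def)
    then have "M \<subseteq> H" using M_min by blast
    \<comment> \<open>A common point recentres both cosets, so \<open>M \<subseteq> H\<close> passes
      to the cosets themselves.\<close>
    moreover obtain a where a: "a \<in> b +o M" "a \<in> c +o H"
      using cofinite_inter_nonempty[OF A b fin] by blast
    moreover have "b +o M = a +o M"
      using M a(1) by (intro coset_eqI) (simp_all add: tail_subgroup_def)
    ultimately have "b +o M \<subseteq> c +o H"
      using coset_eqI[OF H a(2)] by (auto simp: mem_coset_iff)
    then show ?thesis using F_eq by blast
  qed
  then have "{F. essential_subset A F} \<subseteq> Pow (A - (b +o M))" by blast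
  then show ?thesis
    using b finite_subset by blast
qed

end
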